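(* Let $m_1,m_2,m_3>0$. The necessary and sufficient condition for a shape of three bodies on $\mathbb{S}^2$, given by the arc angles $\sigma_{ij}$, to form a Lagrangian relative equilibrium is that the matrix $$J=\left(\begin{array}{ccc}m_2+m_3&-\sqrt{m_1m_2}\cos\sigma_{12}&-\sqrt{m_1m_3}\cos\sigma_{13}\\-\sqrt{m_2m_1}\cos\sigma_{21}&m_3+m_1&-\sqrt{m_2m_3}\cos\sigma_{23}\\-\sqrt{m_3m_1}\cos\sigma_{31}&-\sqrt{m_3m_2}\cos\sigma_{32}&m_1+m_2\end{array}\right)$$ has the eigenvector $$\Psi_L=\left(\frac{\sqrt{m_1}}{U'(\cos\sigma_{23})},\frac{\sqrt{m_2}}{U'(\cos\sigma_{31})},\frac{\sqrt{m_3}}{U'(\cos\sigma_{12})}\right)\Big/\left(\frac{m_1}{U'(\cos\sigma_{23})^2}+\frac{m_2}{U'(\cos\sigma_{31})^2}+\frac{m_3}{U'(\cos\sigma_{12})^2}\right)^{1/2}.$$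
   Context: Three point masses $m_k>0$ move on the unit sphere $\mathbb{S}^2$ with spherical coordinates $(\theta_k,\phi_k)$, that is, with positions $(\sin\theta_k\cos\phi_k,\sin\theta_k\sin\phi_k,\cos\theta_k)$. The arc angle $\sigma_{ij}=\sigma_{ji}\in[0,\pi]$ between bodies $i$ and $j$ is the angle between them seen from the centre of the sphere, so $\cos\sigma_{ij}=\cos\theta_i\cos\theta_j+\sin\theta_i\sin\theta_j\cos(\phi_i-\phi_j)$. A shape is the set of arc angles $\sigma_{ij}$. The equations of motion are the Euler-Lagrange equations of $L=\sum_k\frac{m_k}{2}(\dot\theta_k^2+\sin^2(\theta_k)\dot\phi_k^2)+\sum_{i<j}m_im_jU(\cos\sigma_{ij})$, where $U'(\cos\sigma)=dU(\cos\sigma)/d(\cos\sigma)$ is assumed continuous and of definite sign for all $\sigma\in(0,\pi)$ ($U'>0$ stands for an attractive force, $U'<0$ for a repulsive force). A relative equilibrium is a solution of the equations of motion which, if the $z$-axis is properly chosen, satisfies $\dot\theta_k=0$ and $\phi_k(t)=\phi_k(0)+\omega t$ for all $k$, with $\omega$ constant. A Lagrangian relative equilibrium is a relative equilibrium of three bodies that are not all on the same geodesic (great circle).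
   Formalization: For a repulsive force (U'<0) only necessity is stated, as sufficiency fails there (equal masses, all arc angles π/2); the arc angles are assumed to be those of three points not on one great circle, as sufficiency fails otherwise (equal masses, all arc angles 2π/3). *)

theory Defs
  imports "HOL-Analysis.Analysis"
begin

section \<open>Euler--Lagrange equations\<close>

text \<open>Here \<open>v\<close> is the velocity, \<open>p\<close> the momentum
  (the gradient of \<open>L\<close> in the velocities) and \<open>f\<close> the generalized force
  (the gradient of \<open>L\<close> in the coordinates). All derivatives are required to exist, so a
  solution never meets a configuration where \<open>L\<close> is not differentiable.\<close>

definition euler_lagrange :: "('a::real_inner \<Rightarrow> 'a \<Rightarrow> real) \<Rightarrow> (real \<Rightarrow> 'a) \<Rightarrow> bool" where
  "euler_lagrange L q \<longleftrightarrow> (\<exists>v p f. \<forall>t.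
     (q has_vector_derivative v t) (at t) \<and>
     GDERIV (\<lambda>w. L (q t) w) (v t) :> p t \<and>
     GDERIV (\<lambda>x. L x (v t)) (q t) :> f t \<and>
     (p has_vector_derivative f t) (at t))"


section \<open>Bodies on the unit sphere\<close>

text \<open>Bodies are indexed by the three-element type \<^typ>\<open>3\<close>, in which \<open>3 = 0\<close>.
  A configuration in spherical coordinates is a pair
  \<open>((\<theta>\<^sub>1, \<theta>\<^sub>2, \<theta>\<^sub>3), (\<phi>\<^sub>1, \<phi>\<^sub>2, \<phi>\<^sub>3))\<close>.\<close>

type_synonym config = "(real^3) \<times> (real^3)"

definition position :: "config \<Rightarrow> 3 \<Rightarrow> real^3" where
  "position x k = (let \<theta> = fst x $ k; \<phi> = snd x $ k in
     vector [sin \<theta> * cos \<phi>, sin \<theta> * sin \<phi>, cos \<theta>])"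

text \<open>For unit vectors this is the angle in \<open>[0, \<pi>]\<close> seen from the origin.\<close>

definition arc_angle :: "real^3 \<Rightarrow> real^3 \<Rightarrow> real" where
  "arc_angle a b = arccos (a \<bullet> b)"

definition cos_arc :: "config \<Rightarrow> 3 \<Rightarrow> 3 \<Rightarrow> real" where
  "cos_arc x i j = cos (fst x $ i) * cos (fst x $ j)
     + sin (fst x $ i) * sin (fst x $ j) * cos (snd x $ i - snd x $ j)"

lemma inner_position: "position x i \<bullet> position x j = cos_arc x i j"
  by (simp add: position_def cos_arc_def Let_def inner_vec_def sum_3 vector_3 cos_diff algebra_simps)

lemma norm_position: "norm (position x i) = 1"
proof -
  have "position x i \<bullet> position x i = 1"
    by (simp add: inner_position cos_arc_def flip: power2_eq_square)
  then show ?thesis by (simp add: norm_eq_1)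
qed

lemma cos_arc_angle: "cos (arc_angle (position x i) (position x j)) = cos_arc x i j"
proof -
  have "\<bar>position x i \<bullet> position x j\<bar> \<le> 1"
    using Cauchy_Schwarz_ineq2[of "position x i" "position x j"] by (simp add: norm_position)
  then show ?thesis
    by (simp add: arc_angle_def cos_arccos_abs flip: inner_position)
qed

definition on_common_geodesic :: "(3 \<Rightarrow> real^3) \<Rightarrow> bool" where
  "on_common_geodesic a \<longleftrightarrow> (\<exists>n. n \<noteq> 0 \<and> (\<forall>k. n \<bullet> a k = 0))"

text \<open>A shape is a family of arc angles \<open>\<sigma> i j\<close>; the diagonal entries carry no information.\<close>

definition has_shape :: "(3 \<Rightarrow> real^3) \<Rightarrow> (3 \<Rightarrow> 3 \<Rightarrow> real) \<Rightarrow> bool" where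
  "has_shape a \<sigma> \<longleftrightarrow> (\<forall>i j. i \<noteq> j \<longrightarrow> \<sigma> i j = arc_angle (a i) (a j))"

definition nongeodesic_shape :: "(3 \<Rightarrow> 3 \<Rightarrow> real) \<Rightarrow> bool" where
  "nongeodesic_shape \<sigma> \<longleftrightarrow>
     (\<exists>a. (\<forall>k. norm (a k) = 1) \<and> \<not> on_common_geodesic a \<and> has_shape a \<sigma>)"


section \<open>Relative equilibria\<close>

definition lagrangian :: "(3 \<Rightarrow> real) \<Rightarrow> (real \<Rightarrow> real) \<Rightarrow> config \<Rightarrow> config \<Rightarrow> real" where
  "lagrangian m U x v =
     (\<Sum>k\<in>UNIV. m k / 2 * ((fst v $ k)\<^sup>2 + (sin (fst x $ k))\<^sup>2 * (snd v $ k)\<^sup>2))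
     + (\<Sum>(i, j)\<in>{(1, 2), (1, 3), (2, 3)}. m i * m j * U (cos_arc x i j))"

text \<open>The spherical coordinates are taken about the axis of rotation.\<close>

definition relative_equilibrium :: "(3 \<Rightarrow> real) \<Rightarrow> (real \<Rightarrow> real) \<Rightarrow> (real \<Rightarrow> config) \<Rightarrow> bool" where
  "relative_equilibrium m U q \<longleftrightarrow> euler_lagrange (lagrangian m U) q \<and>
     (\<exists>\<omega>. \<forall>t k. ((\<lambda>s. fst (q s) $ k) has_real_derivative 0) (at t) \<and>
              snd (q t) $ k = snd (q 0) $ k + \<omega> * t)"

text \<open>At a pole the coordinates are singular: the coordinate equations of a body sitting there
  are weaker than Newton's equations. This is harmless for the next definition, because for a
  force that never vanishes the equations of the other two bodies then put all three bodies on one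
  great circle.\<close>

definition lagrangian_RE :: "(3 \<Rightarrow> real) \<Rightarrow> (real \<Rightarrow> real) \<Rightarrow> (real \<Rightarrow> config) \<Rightarrow> bool" where
  "lagrangian_RE m U q \<longleftrightarrow>
     relative_equilibrium m U q \<and> (\<forall>t. \<not> on_common_geodesic (position (q t)))"

text \<open>Arc angles do not depend on the choice of the z-axis, so quantifying over motions written
  in coordinates about the axis of rotation amounts to choosing that axis.\<close>

definition forms_lagrangian_RE :: "(3 \<Rightarrow> real) \<Rightarrow> (real \<Rightarrow> real) \<Rightarrow> (3 \<Rightarrow> 3 \<Rightarrow> real) \<Rightarrow> bool" where
  "forms_lagrangian_RE m U \<sigma> \<longleftrightarrow>
     (\<exists>q. lagrangian_RE m U q \<and> (\<forall>t. has_shape (position (q t)) \<sigma>))"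


section \<open>The matrix and the vector of the criterion\<close>

definition J_mat :: "(3 \<Rightarrow> real) \<Rightarrow> (3 \<Rightarrow> 3 \<Rightarrow> real) \<Rightarrow> real^3^3" where
  "J_mat m \<sigma> = vector
     [vector [m 2 + m 3, - sqrt (m 1 * m 2) * cos (\<sigma> 1 2), - sqrt (m 1 * m 3) * cos (\<sigma> 1 3)],
      vector [- sqrt (m 2 * m 1) * cos (\<sigma> 2 1), m 3 + m 1, - sqrt (m 2 * m 3) * cos (\<sigma> 2 3)],
      vector [- sqrt (m 3 * m 1) * cos (\<sigma> 3 1), - sqrt (m 3 * m 2) * cos (\<sigma> 3 2), m 1 + m 2]]"

definition Psi_L :: "(3 \<Rightarrow> real) \<Rightarrow> (real \<Rightarrow> real) \<Rightarrow> (3 \<Rightarrow> 3 \<Rightarrow> real) \<Rightarrow> real^3" where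
  "Psi_L m U' \<sigma> =
     (1 / sqrt (m 1 / (U' (cos (\<sigma> 2 3)))\<^sup>2 + m 2 / (U' (cos (\<sigma> 3 1)))\<^sup>2 + m 3 / (U' (cos (\<sigma> 1 2)))\<^sup>2))
     *\<^sub>R vector [sqrt (m 1) / U' (cos (\<sigma> 2 3)),
                sqrt (m 2) / U' (cos (\<sigma> 3 1)),
                sqrt (m 3) / U' (cos (\<sigma> 1 2))]"

definition has_eigenvector :: "real^'n^'n \<Rightarrow> real^'n \<Rightarrow> bool" where
  "has_eigenvector A v \<longleftrightarrow> v \<noteq> 0 \<and> (\<exists>c. A *v v = c *\<^sub>R v)"

end

theory Submission
  imports Defs
begin

text \<open>
  Write \<open>x\<^sub>k\<close> for the positions and give body \<open>k\<close> the weight \<open>r\<^sub>k = 1 / U'(cos \<sigma>)\<close>, with \<open>\<sigma>\<close> the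
  arc between the two other bodies. With \<open>G\<close> the product of the three values of \<open>U'\<close>, the
  strength of the interaction of two distinct bodies is \<open>U'(cos \<sigma>\<^sub>i\<^sub>j) = G r\<^sub>i r\<^sub>j\<close>. This factorization,
  special to three bodies, makes all pulls parallel to one line: up to a multiple of its own position,
  which has no effect on the sphere, body \<open>k\<close> is pulled along \<open>G r\<^sub>k h\<close>, where
  \<open>h = \<Sum>\<^sub>j m\<^sub>j r\<^sub>j x\<^sub>j\<close> is the same vector for all three.

  A uniform rotation about the vertical is a solution exactly when no pull has a component along a
  circle of latitude and each pull along the meridian balances the centrifugal term
  (\<open>relative_equilibrium_imp_balanced\<close>, \<open>balanced_imp_relative_equilibrium\<close>). The first condition
  says that the horizontal part of \<open>h\<close>, turned by a right angle, is orthogonal to every position;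
  as the bodies are not on a great circle, \<open>h\<close> is vertical, \<open>h = \<eta> e\<^sub>z\<close>. The second then reads
  \<open>\<omega>\<^sup>2 cos \<theta>\<^sub>k = G \<eta> r\<^sub>k\<close>: the heights are proportional to the weights. Since
  \<open>\<eta> cos \<theta>\<^sub>k = x\<^sub>k \<bullet> h\<close>, this is the eigenvalue equation
  \<open>\<Sum>\<^sub>j m\<^sub>j r\<^sub>j cos \<sigma>\<^sub>k\<^sub>j = \<mu> r\<^sub>k\<close> with \<open>\<mu> = G \<eta>\<^sup>2 / \<omega>\<^sup>2\<close> (\<open>balanced_imp_eigen\<close>), in which the rotation axis
  no longer appears. It is the eigenvector condition for \<open>J\<close>, because the rows of \<open>J\<close> differ from
  this equation only by the total mass on the diagonal and factors \<open>\<surd>m\<^sub>k\<close> (\<open>has_eigenvector_iff\<close>).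

  Conversely the eigenvalue equation forces \<open>\<mu> > 0\<close>, because \<open>\<bar>h\<bar>\<^sup>2 = \<mu> \<Sum>\<^sub>k m\<^sub>k r\<^sub>k\<^sup>2\<close>. For an attractive
  force \<open>G > 0\<close>, so \<open>\<omega>\<^sup>2 = G \<bar>h\<bar>\<^sup>2 / \<mu>\<close> has a real solution, and turning the triangle until \<open>h\<close> is
  vertical gives the relative equilibrium (\<open>eigen_imp_balanced\<close>). For a repulsive force \<open>G < 0\<close>
  and there is no such \<open>\<omega>\<close>.
\<close>


section \<open>Nongeodesic triples of unit vectors\<close>

text \<open>A normal of a great circle through the bodies is a vector in the kernel of the square matrix whose rows are the
  positions, and a linear relation between them is a vector in the kernel of its transpose.\<close>

lemma nongeodesic_iff_independent:
  "\<not> on_common_geodesic a \<longleftrightarrow> (\<forall>\<alpha>. (\<Sum>k\<in>UNIV. \<alpha> k *\<^sub>R a k) = 0 \<longrightarrow> (\<forall>k. \<alpha> k = 0))"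
proof -
  define A :: "real^3^3" where "A = (\<chi> k. a k)"
  have A: "A *v n = (\<chi> k. n \<bullet> a k)" for n
    by (simp add: A_def matrix_vector_mult_def inner_vec_def vec_eq_iff mult.commute)
  have "\<not> on_common_geodesic a \<longleftrightarrow> (\<forall>n. A *v n = 0 \<longrightarrow> n = 0)"
    unfolding on_common_geodesic_def A by (auto simp: vec_eq_iff)
  also have "\<dots> \<longleftrightarrow> (\<exists>B. A ** B = mat 1)"
    unfolding matrix_left_invertible_ker[symmetric] using matrix_left_right_inverse by metis
  also have "\<dots> \<longleftrightarrow> (\<forall>\<alpha>. (\<Sum>k\<in>UNIV. \<alpha> k *\<^sub>R a k) = 0 \<longrightarrow> (\<forall>k. \<alpha> k = 0))"
    unfolding matrix_right_invertible_independent_rows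
    by (simp add: row_def A_def vec_lambda_eta scalar_mult_eq_scaleR)
  finally show ?thesis .
qed

lemma nongeodesic_coefficient_zero:
  assumes "\<not> on_common_geodesic a" and "(\<Sum>k\<in>UNIV. \<alpha> k *\<^sub>R a k) = 0"
  shows "\<alpha> k = 0"
  using assms unfolding nongeodesic_iff_independent by (elim allE[of _ \<alpha>]) simp

text \<open>Linear independence can be read off the Gram matrix. Hence being off a geodesic is a property of the
  arc angles, invariant under rotations.\<close>

lemma nongeodesic_cong_inner:
  assumes "\<not> on_common_geodesic a" and gram: "\<And>i j. a i \<bullet> a j = b i \<bullet> b j"
  shows "\<not> on_common_geodesic b"
proof -
  have norms: "norm (\<Sum>k\<in>UNIV. \<alpha> k *\<^sub>R a k) = norm (\<Sum>k\<in>UNIV. \<alpha> k *\<^sub>R b k)" for \<alpha> :: "3 \<Rightarrow> real"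
    unfolding norm_eq_sqrt_inner inner_sum_left inner_sum_right inner_scaleR_left inner_scaleR_right gram ..
  show ?thesis
    unfolding nongeodesic_iff_independent
  proof (intro allI impI)
    fix \<alpha> :: "3 \<Rightarrow> real" and k
    assume "(\<Sum>k\<in>UNIV. \<alpha> k *\<^sub>R b k) = 0"
    with norms[of \<alpha>] have "(\<Sum>k\<in>UNIV. \<alpha> k *\<^sub>R a k) = 0"
      by simp
    then show "\<alpha> k = 0"
      using assms(1) by (simp add: nongeodesic_iff_independent)
  qed
qed

text \<open>Two bodies of a nongeodesic triple neither coincide nor are antipodal, so \<^term>\<open>U'\<close> is only ever
  evaluated in the open interval where it is controlled.\<close>

lemma nongeodesic_inner_bounds:
  assumes "\<not> on_common_geodesic a" and unit: "\<And>k. norm (a k) = 1" and "i \<noteq> j"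
  shows "a i \<bullet> a j \<in> {-1<..<1}"
proof -
  have indep: "s *\<^sub>R a i + t *\<^sub>R a j \<noteq> 0" if "s \<noteq> 0" for s t
  proof
    assume "s *\<^sub>R a i + t *\<^sub>R a j = 0"
    moreover have "(\<Sum>k\<in>UNIV. (if k = i then s else if k = j then t else 0) *\<^sub>R a k)
        = (\<Sum>k\<in>{i, j}. (if k = i then s else if k = j then t else 0) *\<^sub>R a k)"
      by (rule sum.mono_neutral_right) auto
    ultimately have "(\<Sum>k\<in>UNIV. (if k = i then s else if k = j then t else 0) *\<^sub>R a k) = 0"
      using \<open>i \<noteq> j\<close> by simp
    then show False
      using assms(1)[unfolded nongeodesic_iff_independent, rule_format, of _ i] that by force
  qed
  have "a i \<bullet> a i = 1" "a j \<bullet> a j = 1"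
    using unit by (simp_all add: norm_eq_1[THEN iffD1])
  then have expand: "(1 *\<^sub>R a i + t *\<^sub>R a j) \<bullet> (1 *\<^sub>R a i + t *\<^sub>R a j) = 1 + t\<^sup>2 + 2 * t * (a i \<bullet> a j)" for t
    by (simp add: inner_add inner_commute power2_eq_square algebra_simps)
  have "1 + t\<^sup>2 + 2 * t * (a i \<bullet> a j) > 0" for t
    unfolding expand[symmetric] inner_gt_zero_iff by (rule indep) simp
  from this[of 1] this[of "-1"] show ?thesis by simp
qed


section \<open>The gradient of the Lagrangian\<close>

text \<open>The tangent vectors \<open>\<partial>x\<^sub>k/\<partial>\<theta>\<^sub>k\<close> and \<open>\<partial>x\<^sub>k/\<partial>\<phi>\<^sub>k\<close> of the coordinate lines. The second one is not
  normalized: it vanishes at the poles.\<close>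

definition meridian :: "config \<Rightarrow> 3 \<Rightarrow> real^3" where
  "meridian x k = vector
     [cos (fst x $ k) * cos (snd x $ k), cos (fst x $ k) * sin (snd x $ k), - sin (fst x $ k)]"

definition parallel :: "config \<Rightarrow> 3 \<Rightarrow> real^3" where
  "parallel x k = vector
     [- sin (fst x $ k) * sin (snd x $ k), sin (fst x $ k) * cos (snd x $ k), 0]"

text \<open>The force per unit mass on body \<open>k\<close>, before projection to the tangent plane of the sphere.\<close>

definition pull :: "(3 \<Rightarrow> real) \<Rightarrow> (real \<Rightarrow> real) \<Rightarrow> config \<Rightarrow> 3 \<Rightarrow> real^3" where
  "pull m U' x k = (\<Sum>j\<in>UNIV - {k}. (m j * U' (cos_arc x k j)) *\<^sub>R position x j)"

lemma inner_meridian_position: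
  "meridian x i \<bullet> position x j = cos (fst x $ i) * sin (fst x $ j) * cos (snd x $ i - snd x $ j)
     - sin (fst x $ i) * cos (fst x $ j)"
  by (simp add: position_def meridian_def Let_def inner_vec_def sum_3 cos_diff algebra_simps)

lemma inner_parallel_position:
  "parallel x i \<bullet> position x j = - (sin (fst x $ i) * sin (fst x $ j) * sin (snd x $ i - snd x $ j))"
  by (simp add: position_def parallel_def Let_def inner_vec_def sum_3 sin_diff algebra_simps)

lemma has_derivative_coords [derivative_intros]:
  "((\<lambda>x::config. fst x $ k) has_derivative (\<lambda>h. fst h $ k)) (at x)"
  "((\<lambda>x::config. snd x $ k) has_derivative (\<lambda>h. snd h $ k)) (at x)"
  by (intro bounded_linear_imp_has_derivative bounded_linear_vec_nth[THEN bounded_linear_compose]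
      bounded_linear_fst bounded_linear_snd)+

text \<open>The product rule for \<open>cos \<sigma>\<^sub>i\<^sub>j = x\<^sub>i \<bullet> x\<^sub>j\<close>. Keeping the tangent vectors as vectors makes the
  generalized forces below inner products with \<^const>\<open>pull\<close>.\<close>

lemma has_derivative_cos_arc:
  "((\<lambda>x. cos_arc x i j) has_derivative
     (\<lambda>h. (fst h $ i *\<^sub>R meridian x i + snd h $ i *\<^sub>R parallel x i) \<bullet> position x j
        + (fst h $ j *\<^sub>R meridian x j + snd h $ j *\<^sub>R parallel x j) \<bullet> position x i)) (at x)"
  unfolding cos_arc_def inner_add_left inner_scaleR_left
    inner_meridian_position inner_parallel_position
  by (rule derivative_eq_intros refl)+
    (simp add: fun_eq_iff cos_diff sin_diff algebra_simps)

lemma cos_arc_commute: "cos_arc x i j = cos_arc x j i"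
  by (metis inner_position inner_commute)

lemma sum_over_pairs:
  fixes f :: "3 \<Rightarrow> 3 \<Rightarrow> 'a::comm_monoid_add"
  shows "(\<Sum>(i, j)\<in>{(1, 2), (1, 3), (2, 3)}. f i j) = f 1 2 + f 1 3 + f 2 3"
  by (simp add: add.assoc)

lemma pull_3:
  "pull m U' x 1 = (m 2 * U' (cos_arc x 1 2)) *\<^sub>R position x 2 + (m 3 * U' (cos_arc x 1 3)) *\<^sub>R position x 3"
  "pull m U' x 2 = (m 1 * U' (cos_arc x 1 2)) *\<^sub>R position x 1 + (m 3 * U' (cos_arc x 2 3)) *\<^sub>R position x 3"
  "pull m U' x 3 = (m 1 * U' (cos_arc x 1 3)) *\<^sub>R position x 1 + (m 2 * U' (cos_arc x 2 3)) *\<^sub>R position x 2"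
proof -
  have "UNIV - {1::3} = {2, 3}" "UNIV - {2::3} = {1, 3}" "UNIV - {3::3} = {1, 2}"
    unfolding set_eq_iff forall_3 by simp_all
  then show
    "pull m U' x 1 = (m 2 * U' (cos_arc x 1 2)) *\<^sub>R position x 2 + (m 3 * U' (cos_arc x 1 3)) *\<^sub>R position x 3"
    "pull m U' x 2 = (m 1 * U' (cos_arc x 1 2)) *\<^sub>R position x 1 + (m 3 * U' (cos_arc x 2 3)) *\<^sub>R position x 3"
    "pull m U' x 3 = (m 1 * U' (cos_arc x 1 3)) *\<^sub>R position x 1 + (m 2 * U' (cos_arc x 2 3)) *\<^sub>R position x 2"
    by (simp_all add: pull_def cos_arc_commute[of x 2 1] cos_arc_commute[of x 3 1] cos_arc_commute[of x 3 2])
qed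

lemma GDERIV_lagrangian_coordinates:
  assumes U: "\<And>i j. i \<noteq> j \<Longrightarrow> (U has_real_derivative U' (cos_arc x i j)) (at (cos_arc x i j))"
  shows "GDERIV (\<lambda>x. lagrangian m U x v) x :>
    ((\<chi> k. m k * (sin (fst x $ k) * cos (fst x $ k) * (snd v $ k)\<^sup>2 + meridian x k \<bullet> pull m U' x k)),
     (\<chi> k. m k * (parallel x k \<bullet> pull m U' x k)))"
proof -
  have U_arc: "((\<lambda>x. U (cos_arc x i j)) has_derivative (\<lambda>h. U' (cos_arc x i j) *
       ((fst h $ i *\<^sub>R meridian x i + snd h $ i *\<^sub>R parallel x i) \<bullet> position x j
        + (fst h $ j *\<^sub>R meridian x j + snd h $ j *\<^sub>R parallel x j) \<bullet> position x i))) (at x)"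
    if "i \<noteq> j" for i j
    using has_derivative_compose[OF has_derivative_cos_arc U[OF that, unfolded has_field_derivative_def]] .
  show ?thesis
    unfolding gderiv_def lagrangian_def sum_over_pairs sum_3 power2_eq_square
    by (rule derivative_eq_intros U_arc refl | simp)+
      (simp add: fun_eq_iff inner_prod_def inner_vec_def[where 'b=3] sum_3 pull_3 inner_add_left inner_add_right
        power2_eq_square algebra_simps)
qed

lemma GDERIV_lagrangian_velocities:
  "GDERIV (\<lambda>w. lagrangian m U x w) v :>
     ((\<chi> k. m k * fst v $ k), (\<chi> k. m k * (sin (fst x $ k))\<^sup>2 * snd v $ k))"
  unfolding gderiv_def lagrangian_def sum_3 power2_eq_square
  by (rule derivative_eq_intros refl)+
    (simp add: fun_eq_iff inner_prod_def inner_vec_def sum_3 algebra_simps)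


section \<open>Uniform rotations\<close>

text \<open>The equations of motion, divided by \<open>m\<^sub>k\<close>, at an instant of uniform rotation with angular
  velocity \<open>\<omega>\<close>.\<close>

definition balanced :: "(3 \<Rightarrow> real) \<Rightarrow> (real \<Rightarrow> real) \<Rightarrow> real \<Rightarrow> config \<Rightarrow> bool" where
  "balanced m U' \<omega> x \<longleftrightarrow> (\<forall>k. parallel x k \<bullet> pull m U' x k = 0 \<and>
     meridian x k \<bullet> pull m U' x k = - (\<omega>\<^sup>2 * sin (fst x $ k) * cos (fst x $ k)))"

lemma GDERIV_unique:
  assumes "GDERIV f x :> D" "GDERIV f x :> D'"
  shows "D = D'"
  using has_derivative_unique[OF assms[unfolded gderiv_def]] by (simp add: fun_eq_iff vector_eq_ldot)

lemma coords_has_real_derivative: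
  assumes "(q has_vector_derivative d) (at t)"
  shows "((\<lambda>s. fst (q s :: config) $ k) has_real_derivative fst d $ k) (at t)"
    and "((\<lambda>s. snd (q s :: config) $ k) has_real_derivative snd d $ k) (at t)"
proof -
  have "bounded_linear (\<lambda>x :: config. fst x $ k)" "bounded_linear (\<lambda>x :: config. snd x $ k)"
    by (intro bounded_linear_vec_nth[THEN bounded_linear_compose] bounded_linear_fst bounded_linear_snd)+
  from this[THEN bounded_linear.has_vector_derivative, OF assms] show
    "((\<lambda>s. fst (q s :: config) $ k) has_real_derivative fst d $ k) (at t)"
    "((\<lambda>s. snd (q s :: config) $ k) has_real_derivative snd d $ k) (at t)"
    by (simp_all add: has_real_derivative_iff_has_vector_derivative)
qed

text \<open>In uniform rotation the momenta \<open>m\<^sub>k \<theta>\<^sub>k' = 0\<close> and \<open>m\<^sub>k sin\<^sup>2 \<theta>\<^sub>k \<phi>\<^sub>k'\<close> are constant, so the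
  generalized forces vanish.\<close>

lemma relative_equilibrium_imp_balanced:
  assumes mass_pos: "\<And>k. m k > 0"
    and U: "\<And>i j. i \<noteq> j \<Longrightarrow>
      (U has_real_derivative U' (cos_arc (q 0) i j)) (at (cos_arc (q 0) i j))"
    and "relative_equilibrium m U q"
  obtains \<omega> where "balanced m U' \<omega> (q 0)"
proof -
  obtain v p f where v: "\<And>t. (q has_vector_derivative v t) (at t)"
    and p: "\<And>t. GDERIV (\<lambda>w. lagrangian m U (q t) w) (v t) :> p t"
    and f: "\<And>t. GDERIV (\<lambda>x. lagrangian m U x (v t)) (q t) :> f t"
    and pf: "\<And>t. (p has_vector_derivative f t) (at t)"
    using assms(3) unfolding relative_equilibrium_def euler_lagrange_def by metis
  obtain \<omega> where \<theta>: "\<And>t k. ((\<lambda>s. fst (q s) $ k) has_real_derivative 0) (at t)"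
    and \<phi>: "\<And>t k. snd (q t) $ k = snd (q 0) $ k + \<omega> * t"
    using assms(3) unfolding relative_equilibrium_def by metis
  have v\<theta>: "fst (v t) $ k = 0" for t k
    using DERIV_unique[OF \<theta> coords_has_real_derivative(1)[OF v]] by simp
  have "((\<lambda>s. snd (q s) $ k) has_real_derivative \<omega>) (at t)" for t k
    by (subst \<phi>) (auto intro!: derivative_eq_intros)
  then have v\<phi>: "snd (v t) $ k = \<omega>" for t k
    using DERIV_unique[OF _ coords_has_real_derivative(2)[OF v]] by metis
  have p_eq: "fst (p t) $ k = 0" "snd (p t) $ k = m k * (sin (fst (q t) $ k))\<^sup>2 * \<omega>" for t k
    unfolding GDERIV_unique[OF p GDERIV_lagrangian_velocities] by (simp_all add: v\<theta> v\<phi>)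
  have "((\<lambda>t. m k * (sin (fst (q t) $ k))\<^sup>2 * \<omega>) has_real_derivative 0) (at t)" for t k
    by (rule derivative_eq_intros \<theta> refl)+ simp
  then have "snd (f t) $ k = 0" for t k
    using DERIV_unique[OF _ coords_has_real_derivative(2)[OF pf]] unfolding p_eq by metis
  moreover have "fst (f t) $ k = 0" for t k
    using DERIV_unique[OF _ coords_has_real_derivative(1)[OF pf]] unfolding p_eq
    by (metis DERIV_const)
  ultimately have "snd (f 0) $ k = 0" "fst (f 0) $ k = 0" for k
    by auto
  moreover have "f 0 = ((\<chi> k. m k * (sin (fst (q 0) $ k) * cos (fst (q 0) $ k) * (snd (v 0) $ k)\<^sup>2
        + meridian (q 0) k \<bullet> pull m U' (q 0) k)),
      (\<chi> k. m k * (parallel (q 0) k \<bullet> pull m U' (q 0) k)))"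
    by (rule GDERIV_unique[OF f GDERIV_lagrangian_coordinates]) (rule U)
  ultimately have "m k * (parallel (q 0) k \<bullet> pull m U' (q 0) k) = 0"
    "m k * (sin (fst (q 0) $ k) * cos (fst (q 0) $ k) * \<omega>\<^sup>2 + meridian (q 0) k \<bullet> pull m U' (q 0) k) = 0"
    for k
    by (simp_all add: v\<phi>)
  then have zero: "parallel (q 0) k \<bullet> pull m U' (q 0) k = 0"
    "sin (fst (q 0) $ k) * cos (fst (q 0) $ k) * \<omega>\<^sup>2 + meridian (q 0) k \<bullet> pull m U' (q 0) k = 0"
    for k
    using mass_pos[of k] by (metis less_irrefl mult_eq_0_iff)+
  have "balanced m U' \<omega> (q 0)"
    unfolding balanced_def
  proof (intro allI conjI)
    fix k
    show "meridian (q 0) k \<bullet> pull m U' (q 0) k = - (\<omega>\<^sup>2 * sin (fst (q 0) $ k) * cos (fst (q 0) $ k))"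
      using zero(2)[of k] by algebra
  qed (rule zero(1))
  then show thesis ..
qed

text \<open>Forces depend on the longitudes through their differences only, so the equations at one instant
  persist under the rotation.\<close>

lemma balanced_imp_relative_equilibrium:
  assumes U: "\<And>i j. i \<noteq> j \<Longrightarrow>
      (U has_real_derivative U' (cos_arc x i j)) (at (cos_arc x i j))"
    and "balanced m U' \<omega> x"
  shows "relative_equilibrium m U (\<lambda>t. (fst x, snd x + (\<omega> * t) *\<^sub>R 1))"
    (is "relative_equilibrium m U ?q")
proof -
  have arc: "cos_arc (?q t) i j = cos_arc x i j" for t i j
    by (simp add: cos_arc_def)
  have "meridian (?q t) k \<bullet> pull m U' (?q t) k = meridian x k \<bullet> pull m U' x k"
    "parallel (?q t) k \<bullet> pull m U' (?q t) k = parallel x k \<bullet> pull m U' x k" for t k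
    by (simp_all add: pull_def inner_sum_right arc inner_meridian_position inner_parallel_position)
  with assms(2) have force:
    "parallel (?q t) k \<bullet> pull m U' (?q t) k = 0"
    "meridian (?q t) k \<bullet> pull m U' (?q t) k = - (\<omega>\<^sup>2 * sin (fst x $ k) * cos (fst x $ k))" for t k
    by (simp_all add: balanced_def)
  let ?v = "(0, \<omega> *\<^sub>R 1) :: config"
  let ?p = "(0, \<chi> k. m k * (sin (fst x $ k))\<^sup>2 * \<omega>) :: config"
  have "GDERIV (\<lambda>w. lagrangian m U (?q t) w) ?v :> ?p" for t
    using GDERIV_lagrangian_velocities[of m U "?q t" ?v]
    by (rule GDERIV_subst) (simp add: vec_eq_iff)
  moreover have "GDERIV (\<lambda>x. lagrangian m U x ?v) (?q t) :> 0" for t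
    by (rule GDERIV_subst[OF GDERIV_lagrangian_coordinates[of U U']])
      (use U in \<open>simp_all add: arc force vec_eq_iff prod_eq_iff\<close>)
  moreover have "(?q has_vector_derivative ?v) (at t)" for t
    by (auto intro!: derivative_eq_intros has_vector_derivative_Pair)
  moreover have "((\<lambda>t. ?p) has_vector_derivative 0) (at t)" for t
    by (rule has_vector_derivative_const)
  ultimately have "euler_lagrange (lagrangian m U) ?q"
    unfolding euler_lagrange_def
    by (intro exI[of _ "\<lambda>t. ?v"] exI[of _ "\<lambda>t. ?p"] exI[of _ "\<lambda>t. 0"]) blast
  then show ?thesis
    unfolding relative_equilibrium_def by (auto intro!: exI[of _ \<omega>])
qed


section \<open>Factorization of the interaction\<close>

text \<open>The components of \<^const>\<open>Psi_L\<close> without masses and normalization, as a function of the cosines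
  \<open>c i j\<close> of the arc angles.\<close>

definition opposite_weight :: "(real \<Rightarrow> real) \<Rightarrow> (3 \<Rightarrow> 3 \<Rightarrow> real) \<Rightarrow> 3 \<Rightarrow> real" where
  "opposite_weight U' c k = vector [1 / U' (c 2 3), 1 / U' (c 3 1), 1 / U' (c 1 2)] $ k"

text \<open>In the product of all three strengths and two weights, the weights of \<open>i\<close> and \<open>j\<close> cancel the two
  strengths that involve the third body.\<close>

lemma U'_eq_opposite_weights:
  assumes sym: "\<And>i j. c i j = c j i" and nz: "\<And>i j. i \<noteq> j \<Longrightarrow> U' (c i j) \<noteq> 0" and "i \<noteq> j"
  shows "U' (c i j) = U' (c 1 2) * U' (c 2 3) * U' (c 3 1) * opposite_weight U' c i * opposite_weight U' c j"
proof -
  have nz': "U' (c 1 2) \<noteq> 0" "U' (c 2 3) \<noteq> 0" "U' (c 3 1) \<noteq> 0"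
    by (simp_all add: nz)
  have "\<forall>i j. i \<noteq> j \<longrightarrow> U' (c i j) =
      U' (c 1 2) * U' (c 2 3) * U' (c 3 1) * opposite_weight U' c i * opposite_weight U' c j"
    unfolding forall_3 opposite_weight_def using nz'
    by (simp add: sym[of 2 1] sym[of 3 2] sym[of 1 3])
  with \<open>i \<noteq> j\<close> show ?thesis by blast
qed

definition weighted_sum :: "(3 \<Rightarrow> real) \<Rightarrow> (3 \<Rightarrow> real) \<Rightarrow> (3 \<Rightarrow> real^3) \<Rightarrow> real^3" where
  "weighted_sum m r a = (\<Sum>k\<in>UNIV. (m k * r k) *\<^sub>R a k)"

lemma inner_meridian_self: "meridian x k \<bullet> position x k = 0"
  and inner_parallel_self: "parallel x k \<bullet> position x k = 0"
  by (simp_all add: inner_meridian_position inner_parallel_position mult.commute)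

lemma pull_eq_weighted_sum:
  assumes "\<And>i j. i \<noteq> j \<Longrightarrow> U' (cos_arc x i j) = G * r i * r j"
  shows "pull m U' x k = (G * r k) *\<^sub>R (weighted_sum m r (position x) - (m k * r k) *\<^sub>R position x k)"
proof -
  have "weighted_sum m r (position x) - (m k * r k) *\<^sub>R position x k
      = (\<Sum>j\<in>UNIV - {k}. (m j * r j) *\<^sub>R position x j)"
    by (simp add: weighted_sum_def sum_diff1)
  then show ?thesis
    by (simp add: pull_def scaleR_sum_right assms mult_ac)
qed

text \<open>All three bodies now see the same vector, because the difference between \<^const>\<open>pull\<close> and a multiple
  of it is normal to the sphere.\<close>

lemma balanced_iff_weighted_sum:
  assumes strengths: "\<And>i j. i \<noteq> j \<Longrightarrow> U' (cos_arc x i j) = G * r i * r j"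
    and "G \<noteq> 0" "\<And>k. r k \<noteq> 0"
  shows "balanced m U' \<omega> x \<longleftrightarrow>
    (\<forall>k. parallel x k \<bullet> weighted_sum m r (position x) = 0 \<and>
      G * r k * (meridian x k \<bullet> weighted_sum m r (position x))
        = - (\<omega>\<^sup>2 * sin (fst x $ k) * cos (fst x $ k)))"
proof -
  have "pull m U' x k = (G * r k) *\<^sub>R (weighted_sum m r (position x) - (m k * r k) *\<^sub>R position x k)" for k
    by (rule pull_eq_weighted_sum) (rule strengths)
  then show ?thesis
    by (simp add: balanced_def inner_diff_right inner_meridian_self inner_parallel_self assms(2,3))
qed

text \<open>The inner product of \<open>h\<close> with \<open>\<partial>x\<^sub>k/\<partial>\<phi>\<^sub>k\<close> equals that of the position \<open>x\<^sub>k\<close> with the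
  horizontal part of \<open>h\<close> turned by a right angle. If these vanish for all bodies, the turned vector is the normal of a great circle through them, unless it is zero.\<close>

lemma parallel_perp_imp_vertical:
  assumes "\<not> on_common_geodesic (position x)" and "\<And>k. parallel x k \<bullet> h = 0"
  shows "h = vector [0, 0, h $ 3]"
proof -
  let ?n = "vector [h $ 2, - h $ 1, 0] :: real^3"
  have "?n \<bullet> position x k = parallel x k \<bullet> h" for k
    by (simp add: inner_vec_def sum_3 position_def parallel_def Let_def)
  then have "?n = 0"
    using assms unfolding on_common_geodesic_def by metis
  then show ?thesis
    by (simp add: vec_eq_iff forall_3)
qed


section \<open>The axis-free eigenvalue equation\<close>

lemma spherical_coordinates:
  assumes "\<And>k. norm (b k) = 1"
  obtains x where "position x = b"
proof -
  have "\<exists>\<theta> \<phi>. b k = vector [sin \<theta> * cos \<phi>, sin \<theta> * sin \<phi>, cos \<theta>]" for k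
  proof -
    have "(b k $ 1)\<^sup>2 + (b k $ 2)\<^sup>2 + (b k $ 3)\<^sup>2 = 1"
      using assms[of k] by (simp add: norm_eq_1 inner_vec_def sum_3 power2_eq_square)
    moreover obtain r \<phi> where r: "b k $ 1 = r * cos \<phi>" "b k $ 2 = r * sin \<phi>"
      using polar_Ex by metis
    moreover have "(r * cos \<phi>)\<^sup>2 + (r * sin \<phi>)\<^sup>2 = r\<^sup>2"
      by (simp add: power_mult_distrib flip: distrib_left)
    ultimately have "(b k $ 3)\<^sup>2 + r\<^sup>2 = 1"
      by simp
    then obtain \<theta> where "b k $ 3 = cos \<theta>" "r = sin \<theta>"
      using sincos_total_2pi by metis
    with r have "b k = vector [sin \<theta> * cos \<phi>, sin \<theta> * sin \<phi>, cos \<theta>]"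
      by (simp add: vec_eq_iff forall_3)
    then show ?thesis by blast
  qed
  then obtain \<theta> \<phi> where "\<And>k. b k = vector [sin (\<theta> k) * cos (\<phi> k), sin (\<theta> k) * sin (\<phi> k), cos (\<theta> k)]"
    by metis
  then have "position ((\<chi> k. \<theta> k), (\<chi> k. \<phi> k)) = b"
    by (simp add: fun_eq_iff position_def Let_def)
  then show thesis ..
qed

text \<open>Let \<open>h\<close> be the weighted sum of the positions. It is vertical, \<open>h = \<eta> e\<^sub>z\<close>, and the meridian equation of
  body \<open>k\<close> is \<open>sin \<theta>\<^sub>k (G r\<^sub>k \<eta> - \<omega>\<^sup>2 cos \<theta>\<^sub>k) = 0\<close>. The factor \<open>sin \<theta>\<^sub>k\<close> can be cancelled: at a pole
  \<open>h\<close> would be a multiple of \<open>x\<^sub>k\<close>, a linear relation between the three positions.\<close>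

lemma balanced_imp_eigen:
  assumes nongeodesic: "\<not> on_common_geodesic (position x)"
    and mr: "\<And>k. m k \<noteq> 0" "\<And>k. r k \<noteq> 0" and "G \<noteq> 0"
    and strengths: "\<And>i j. i \<noteq> j \<Longrightarrow> U' (cos_arc x i j) = G * r i * r j"
    and "balanced m U' \<omega> x"
  shows "\<exists>\<mu>. \<forall>k. (\<Sum>j\<in>UNIV. m j * r j * cos_arc x k j) = \<mu> * r k"
proof -
  let ?h = "weighted_sum m r (position x)"
  define \<eta> where "\<eta> = ?h $ 3"
  have par: "parallel x k \<bullet> ?h = 0"
    and mer: "G * r k * (meridian x k \<bullet> ?h) = - (\<omega>\<^sup>2 * sin (fst x $ k) * cos (fst x $ k))" for k
    using assms(6) balanced_iff_weighted_sum[where G = G and r = r and m = m] assms by blast+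
  have h: "?h = vector [0, 0, \<eta>]"
    unfolding \<eta>_def by (rule parallel_perp_imp_vertical[OF nongeodesic par])
  have not_par: "?h \<noteq> s *\<^sub>R position x k" for s k
  proof
    assume "?h = s *\<^sub>R position x k"
    then have "(\<Sum>j\<in>UNIV. (m j * r j - (if j = k then s else 0)) *\<^sub>R position x j) = 0"
      by (simp add: weighted_sum_def scaleR_diff_left sum_subtractf if_distrib[of "\<lambda>t. t *\<^sub>R _"] cong: if_cong)
    then have "m j * r j - (if j = k then s else 0) = 0" for j
      by (rule nongeodesic_coefficient_zero[OF nongeodesic])
    \<comment> \<open>any body other than \<open>k\<close> will do; addition is modulo 3\<close>
    from this[of "k + 1"] mr show False
      by simp
  qed
  have "\<eta> \<noteq> 0"
    using not_par[of 0 1] h by (auto simp: vec_eq_iff forall_3)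
  have sin_nz: "sin (fst x $ k) \<noteq> 0" for k
  proof
    assume "sin (fst x $ k) = 0"
    moreover from this have "cos (fst x $ k) * cos (fst x $ k) = 1"
      using sin_cos_squared_add3[of "fst x $ k"] by simp
    ultimately have "?h = (\<eta> * cos (fst x $ k)) *\<^sub>R position x k"
      by (simp add: h position_def Let_def vec_eq_iff forall_3)
    then show False
      using not_par by blast
  qed
  have height: "G * r k * \<eta> = \<omega>\<^sup>2 * cos (fst x $ k)" for k
  proof -
    have "meridian x k \<bullet> ?h = - sin (fst x $ k) * \<eta>"
      by (simp add: h meridian_def inner_vec_def sum_3)
    then have "sin (fst x $ k) * (G * r k * \<eta>) = sin (fst x $ k) * (\<omega>\<^sup>2 * cos (fst x $ k))"
      using mer[of k] by algebra
    then show ?thesis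
      using sin_nz by simp
  qed
  then have "\<omega>\<^sup>2 \<noteq> 0"
    using \<open>G \<noteq> 0\<close> \<open>\<eta> \<noteq> 0\<close> mr(2) by (metis mult_eq_0_iff)
  have "(\<Sum>j\<in>UNIV. m j * r j * cos_arc x k j) = (G * \<eta>\<^sup>2 / \<omega>\<^sup>2) * r k" for k
  proof -
    have "(\<Sum>j\<in>UNIV. m j * r j * cos_arc x k j) = position x k \<bullet> ?h"
      by (simp add: weighted_sum_def inner_sum_right inner_position)
    also have "\<dots> = \<eta> * cos (fst x $ k)"
      by (simp add: h position_def Let_def inner_vec_def sum_3)
    also have "\<dots> = (G * \<eta>\<^sup>2 / \<omega>\<^sup>2) * r k"
      using height[of k] \<open>\<omega>\<^sup>2 \<noteq> 0\<close> by (simp add: field_simps power2_eq_square)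
    finally show ?thesis .
  qed
  then show ?thesis by blast
qed

text \<open>Let \<open>h\<close> be the weighted sum of the given unit vectors. Pairing the eigenvalue equation with the
  weights \<open>m\<^sub>k r\<^sub>k\<close> gives \<open>\<bar>h\<bar>\<^sup>2 = \<mu> \<Sum>\<^sub>k m\<^sub>k r\<^sub>k\<^sup>2\<close>, hence \<open>\<mu> > 0\<close>. An orthogonal map taking \<open>h\<close> to the vertical
  preserves the arc angles and turns the eigenvalue equation into heights proportional to the
  weights. The angular velocity is the one with \<open>\<omega>\<^sup>2 = G \<bar>h\<bar>\<^sup>2 / \<mu>\<close>, real because \<open>G > 0\<close>.\<close>

lemma eigen_imp_balanced:
  assumes unit: "\<And>k. norm (a k) = 1" and nongeodesic: "\<not> on_common_geodesic a"
    and mr: "\<And>k. m k > 0" "\<And>k. r k \<noteq> 0" and "G > 0"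
    and strengths: "\<And>i j. i \<noteq> j \<Longrightarrow> U' (a i \<bullet> a j) = G * r i * r j"
    and eigen: "\<And>k. (\<Sum>j\<in>UNIV. m j * r j * (a k \<bullet> a j)) = \<mu> * r k"
  shows "\<exists>x \<omega>. (\<forall>i j. cos_arc x i j = a i \<bullet> a j) \<and> balanced m U' \<omega> x"
proof -
  let ?h = "weighted_sum m r a"
  have "?h \<noteq> 0"
  proof
    assume "?h = 0"
    then have "m 1 * r 1 = 0"
      unfolding weighted_sum_def by (rule nongeodesic_coefficient_zero[OF nongeodesic])
    with mr(1)[of 1] mr(2)[of 1] show False
      by simp
  qed
  have a_h: "a k \<bullet> ?h = \<mu> * r k" for k
    using eigen by (simp add: weighted_sum_def inner_sum_right)
  have "(norm ?h)\<^sup>2 = \<mu> * (\<Sum>k\<in>UNIV. m k * (r k)\<^sup>2)"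
    unfolding power2_norm_eq_inner by (subst weighted_sum_def)
      (simp add: inner_sum_left a_h sum_distrib_left power2_eq_square mult_ac)
  moreover have "(\<Sum>k\<in>UNIV. m k * (r k)\<^sup>2) > 0"
    using mr by (intro sum_pos) auto
  moreover have "(norm ?h)\<^sup>2 > 0"
    using \<open>?h \<noteq> 0\<close> by simp
  ultimately have "\<mu> > 0"
    by (simp add: zero_less_mult_iff)
  define \<eta> where "\<eta> = norm ?h"
  have "\<eta> > 0"
    using \<open>?h \<noteq> 0\<close> by (simp add: \<eta>_def)
  have "norm (vector [0, 0, \<eta>] :: real^3) = \<eta>"
    using \<open>\<eta> > 0\<close> by (simp add: norm_vec_def L2_set_def sum_3)
  then have "norm (vector [0, 0, \<eta>] :: real^3) = norm ?h"
    by (simp only: \<eta>_def)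
  from orthogonal_transformation_exists[OF this[symmetric]]
  obtain R :: "real^3 \<Rightarrow> real^3" where R: "orthogonal_transformation R" "R ?h = vector [0, 0, \<eta>]"
    by blast
  have R_inner: "R u \<bullet> R v = u \<bullet> v" for u v
    using R(1) by (simp add: orthogonal_transformation_def)
  have "norm (R (a k)) = 1" for k
    using R(1) unit by (simp add: orthogonal_transformation_norm)
  then obtain x where x: "position x = (\<lambda>k. R (a k))"
    by (rule spherical_coordinates)
  have arc: "cos_arc x i j = a i \<bullet> a j" for i j
    by (simp add: R_inner x flip: inner_position)
  interpret R: linear R
    using R(1) by (rule orthogonal_transformation_linear)
  have h: "weighted_sum m r (position x) = vector [0, 0, \<eta>]"
    by (simp add: x weighted_sum_def R.sum R.scale flip: R(2))
  have height: "\<eta> * cos (fst x $ k) = \<mu> * r k" for k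
  proof -
    have "\<eta> * cos (fst x $ k) = position x k \<bullet> weighted_sum m r (position x)"
      by (simp add: h position_def Let_def inner_vec_def sum_3)
    also have "\<dots> = R (a k) \<bullet> R ?h"
      by (simp add: h R(2)) (simp add: x)
    finally show ?thesis
      by (simp add: R_inner a_h)
  qed
  have "balanced m U' (sqrt (G / \<mu>) * \<eta>) x"
  proof (subst balanced_iff_weighted_sum[of U' x G r])
    show "\<forall>k. parallel x k \<bullet> weighted_sum m r (position x) = 0 \<and>
      G * r k * (meridian x k \<bullet> weighted_sum m r (position x))
        = - ((sqrt (G / \<mu>) * \<eta>)\<^sup>2 * sin (fst x $ k) * cos (fst x $ k))"
    proof (intro allI conjI)
      fix k
      show "parallel x k \<bullet> weighted_sum m r (position x) = 0"
        by (simp add: h parallel_def inner_vec_def sum_3)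
      have tilt: "meridian x k \<bullet> weighted_sum m r (position x) = - (sin (fst x $ k) * \<eta>)"
        by (simp add: h meridian_def inner_vec_def sum_3)
      have "(sqrt (G / \<mu>) * \<eta>)\<^sup>2 * sin (fst x $ k) * cos (fst x $ k)
          = G / \<mu> * \<eta> * sin (fst x $ k) * (\<eta> * cos (fst x $ k))"
        using \<open>G > 0\<close> \<open>\<mu> > 0\<close> by (simp add: power_mult_distrib) (simp add: power2_eq_square)
      also have "\<dots> = G * r k * (sin (fst x $ k) * \<eta>)"
        using \<open>\<mu> > 0\<close> by (simp add: height)
      finally show "G * r k * (meridian x k \<bullet> weighted_sum m r (position x))
        = - ((sqrt (G / \<mu>) * \<eta>)\<^sup>2 * sin (fst x $ k) * cos (fst x $ k))"
        by (simp only: tilt mult_minus_right)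
    qed
  qed (use assms arc in auto)
  with arc show ?thesis by blast
qed


section \<open>The matrix form\<close>

text \<open>Put \<open>w\<^sub>k = \<surd>m\<^sub>k r\<^sub>k\<close>, a nonzero multiple of \<^const>\<open>Psi_L\<close>, and let \<open>M\<close> be the total mass.
  Since the diagonal entry of \<^const>\<open>J_mat\<close> in row \<open>k\<close> is \<open>M - m\<^sub>k\<close>, row \<open>k\<close> of \<open>J w\<close> is
  \<open>\<surd>m\<^sub>k (M r\<^sub>k - \<Sum>\<^sub>j m\<^sub>j r\<^sub>j c\<^sub>k\<^sub>j)\<close>. An eigenvalue \<open>\<kappa>\<close> of \<open>J\<close> thus corresponds to \<open>\<mu> = M - \<kappa>\<close>.\<close>

lemma has_eigenvector_iff:
  assumes mass_pos: "\<And>k. m k > 0"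
    and c: "\<And>i j. i \<noteq> j \<Longrightarrow> cos (\<sigma> i j) = c i j" "\<And>k. c k k = 1"
    and nz: "\<And>i j. i \<noteq> j \<Longrightarrow> U' (c i j) \<noteq> 0"
  shows "has_eigenvector (J_mat m \<sigma>) (Psi_L m U' \<sigma>) \<longleftrightarrow>
    (\<exists>\<mu>. \<forall>k. (\<Sum>j\<in>UNIV. m j * opposite_weight U' c j * c k j) = \<mu> * opposite_weight U' c k)"
proof -
  define r where "r = opposite_weight U' c"
  define w :: "real^3" where "w = (\<chi> k. sqrt (m k) * r k)"
  define N where "N = 1 / sqrt (m 1 * (r 1)\<^sup>2 + m 2 * (r 2)\<^sup>2 + m 3 * (r 3)\<^sup>2)"
  have r_nz: "r 1 \<noteq> 0"
    by (simp add: r_def opposite_weight_def nz)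
  then have "m 1 * (r 1)\<^sup>2 + m 2 * (r 2)\<^sup>2 + m 3 * (r 3)\<^sup>2 > 0"
    using mass_pos by (intro add_pos_nonneg mult_nonneg_nonneg) (auto intro: less_imp_le)
  then have "N \<noteq> 0"
    by (simp add: N_def)
  have "w $ 1 \<noteq> 0"
    using r_nz mass_pos[of 1] by (simp add: w_def)
  then have "w \<noteq> 0"
    by auto
  have Psi: "Psi_L m U' \<sigma> = N *\<^sub>R w"
    by (simp add: Psi_L_def N_def w_def r_def opposite_weight_def c vec_eq_iff forall_3 power_divide)
  have Jw: "(J_mat m \<sigma> *v w) $ k
      = sqrt (m k) * ((\<Sum>j\<in>UNIV. m j) * r k - (\<Sum>j\<in>UNIV. m j * r j * c k j))" for k
  proof -
    have sq: "sqrt (m k) * (sqrt (m k) * t) = m k * t" for k t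
      using mass_pos[of k] by (simp flip: mult.assoc)
    have "\<forall>k. (J_mat m \<sigma> *v w) $ k
      = sqrt (m k) * ((\<Sum>j\<in>UNIV. m j) * r k - (\<Sum>j\<in>UNIV. m j * r j * c k j))"
      unfolding forall_3
      by (simp add: J_mat_def w_def matrix_vector_mult_def sum_3 c real_sqrt_mult algebra_simps sq)
    then show ?thesis ..
  qed
  have "has_eigenvector (J_mat m \<sigma>) (Psi_L m U' \<sigma>) \<longleftrightarrow> (\<exists>\<kappa>. J_mat m \<sigma> *v w = \<kappa> *\<^sub>R w)"
  proof -
    have "J_mat m \<sigma> *v (N *\<^sub>R w) = \<kappa> *\<^sub>R (N *\<^sub>R w) \<longleftrightarrow> J_mat m \<sigma> *v w = \<kappa> *\<^sub>R w" for \<kappa>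
      unfolding matrix_vector_mult_scaleR scaleR_left_commute[of \<kappa> N] scaleR_cancel_left
      using \<open>N \<noteq> 0\<close> by blast
    moreover have "N *\<^sub>R w \<noteq> 0"
      using \<open>N \<noteq> 0\<close> \<open>w \<noteq> 0\<close> by simp
    ultimately show ?thesis
      unfolding has_eigenvector_def Psi by blast
  qed
  also have "\<dots> \<longleftrightarrow> (\<exists>\<kappa>. \<forall>k. (\<Sum>j\<in>UNIV. m j) * r k - (\<Sum>j\<in>UNIV. m j * r j * c k j) = \<kappa> * r k)"
  proof -
    have "sqrt (m k) * s = \<kappa> * (sqrt (m k) * t) \<longleftrightarrow> s = \<kappa> * t" for k s t \<kappa>
      using mass_pos[of k] by (simp add: mult.left_commute)
    then show ?thesis
      by (simp add: vec_eq_iff Jw) (simp add: w_def)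
  qed
  also have "\<dots> \<longleftrightarrow> (\<exists>\<mu>. \<forall>k. (\<Sum>j\<in>UNIV. m j * r j * c k j) = \<mu> * r k)"
  proof -
    define M where "M = (\<Sum>j\<in>UNIV. m j)"
    have "M * t - s = \<kappa> * t \<longleftrightarrow> s = (M - \<kappa>) * t" "s = \<kappa> * t \<longleftrightarrow> M * t - s = (M - \<kappa>) * t" for t s \<kappa>
      by (auto simp: algebra_simps)
    then show ?thesis
      unfolding M_def[symmetric] by blast
  qed
  finally show ?thesis
    by (simp add: r_def)
qed


section \<open>The criterion for a shape\<close>

lemma has_shape_cos:
  assumes "has_shape a \<sigma>" and unit: "\<And>k. norm (a k) = 1" and "i \<noteq> j"
  shows "cos (\<sigma> i j) = a i \<bullet> a j"
proof -
  have "\<bar>a i \<bullet> a j\<bar> \<le> 1"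
    using Cauchy_Schwarz_ineq2[of "a i" "a j"] by (simp add: unit)
  then show ?thesis
    using assms by (simp add: has_shape_def arc_angle_def cos_arccos_abs)
qed

text \<open>The instant \<open>t = 0\<close> of the motion carries all the information: its arc angles are the shape, and
  its equations of motion give the eigenvalue equation for either sign of the force.\<close>

lemma forms_lagrangian_RE_imp_eigenvector:
  assumes mass_pos: "\<And>k. m k > 0"
    and U_deriv: "\<And>c. c \<in> {-1<..<1} \<Longrightarrow> (U has_real_derivative U' c) (at c)"
    and U'_nz: "\<And>c. c \<in> {-1<..<1} \<Longrightarrow> U' c \<noteq> 0"
    and "forms_lagrangian_RE m U \<sigma>"
  shows "has_eigenvector (J_mat m \<sigma>) (Psi_L m U' \<sigma>)"
proof -
  obtain q where RE: "relative_equilibrium m U q"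
    and nongeodesic: "\<not> on_common_geodesic (position (q 0))"
    and shape: "has_shape (position (q 0)) \<sigma>"
    using assms(4) unfolding forms_lagrangian_RE_def lagrangian_RE_def by blast
  define x where "x = q 0"
  define c where "c = cos_arc x"
  define r where "r = opposite_weight U' c"
  have c_bounds: "c i j \<in> {-1<..<1}" if "i \<noteq> j" for i j
    using nongeodesic_inner_bounds[OF nongeodesic norm_position that] by (simp add: inner_position c_def x_def)
  then have nz: "U' (c i j) \<noteq> 0" if "i \<noteq> j" for i j
    using that U'_nz by blast
  have "(U has_real_derivative U' (cos_arc (q 0) i j)) (at (cos_arc (q 0) i j))" if "i \<noteq> j" for i j
    using U_deriv[OF c_bounds[OF that]] by (simp add: c_def x_def)
  from relative_equilibrium_imp_balanced[OF mass_pos this RE]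
  obtain \<omega> where balanced: "balanced m U' \<omega> x"
    unfolding x_def by blast
  have "\<exists>\<mu>. \<forall>k. (\<Sum>j\<in>UNIV. m j * r j * cos_arc x k j) = \<mu> * r k"
  proof (rule balanced_imp_eigen)
    show "\<not> on_common_geodesic (position x)" "balanced m U' \<omega> x"
      using nongeodesic balanced by (simp_all add: x_def)
    show "m k \<noteq> 0" for k
      using mass_pos[of k] by simp
    show "r k \<noteq> 0" for k
      using exhaust_3[of k] by (auto simp: r_def opposite_weight_def nz)
    show "U' (c 1 2) * U' (c 2 3) * U' (c 3 1) \<noteq> 0"
      by (simp add: nz)
    show "U' (cos_arc x i j) = U' (c 1 2) * U' (c 2 3) * U' (c 3 1) * r i * r j" if "i \<noteq> j" for i j
      using U'_eq_opposite_weights[of c U', OF _ nz that] by (simp add: r_def c_def cos_arc_commute)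
  qed
  moreover have "cos (\<sigma> i j) = c i j" if "i \<noteq> j" for i j
    using has_shape_cos[OF shape norm_position that] by (simp add: inner_position c_def x_def)
  moreover have "c k k = 1" for k
    using norm_position[of x k] by (simp add: norm_eq_1 inner_position c_def)
  ultimately show ?thesis
    using has_eigenvector_iff[of m \<sigma> c U', OF mass_pos _ _ nz] by (simp add: r_def c_def)
qed

text \<open>The sign of \<^term>\<open>U'\<close> enters through the product of the three strengths, which has to be
  positive for a real angular velocity to exist.\<close>

lemma eigenvector_imp_forms_lagrangian_RE:
  assumes mass_pos: "\<And>k. m k > 0"
    and U_deriv: "\<And>c. c \<in> {-1<..<1} \<Longrightarrow> (U has_real_derivative U' c) (at c)"
    and U'_pos: "\<And>c. c \<in> {-1<..<1} \<Longrightarrow> U' c > 0"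
    and "nongeodesic_shape \<sigma>"
    and eigenvector: "has_eigenvector (J_mat m \<sigma>) (Psi_L m U' \<sigma>)"
  shows "forms_lagrangian_RE m U \<sigma>"
proof -
  obtain a where unit: "\<And>k. norm (a k) = 1" and nongeodesic: "\<not> on_common_geodesic a"
    and shape: "has_shape a \<sigma>"
    using assms(4) unfolding nongeodesic_shape_def by blast
  define c where "c = (\<lambda>i j. a i \<bullet> a j)"
  define r where "r = opposite_weight U' c"
  have c_bounds: "c i j \<in> {-1<..<1}" if "i \<noteq> j" for i j
    using nongeodesic_inner_bounds[OF nongeodesic unit that] by (simp add: c_def)
  then have pos: "U' (c i j) > 0" if "i \<noteq> j" for i j
    using that U'_pos by blast
  have nz: "U' (c i j) \<noteq> 0" if "i \<noteq> j" for i j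
    using pos[OF that] by simp
  have cos_\<sigma>: "cos (\<sigma> i j) = c i j" if "i \<noteq> j" for i j
    using has_shape_cos[OF shape unit that] by (simp add: c_def)
  have "c k k = 1" for k
    using unit[of k] by (simp add: norm_eq_1 c_def)
  with has_eigenvector_iff[of m \<sigma> c U', OF mass_pos cos_\<sigma> _ nz] eigenvector
  obtain \<mu> where eigen: "\<And>k. (\<Sum>j\<in>UNIV. m j * r j * c k j) = \<mu> * r k"
    unfolding r_def by auto
  have "\<exists>x \<omega>. (\<forall>i j. cos_arc x i j = a i \<bullet> a j) \<and> balanced m U' \<omega> x"
  proof (rule eigen_imp_balanced[OF unit nongeodesic mass_pos])
    show "r k \<noteq> 0" for k
      using exhaust_3[of k] by (auto simp: r_def opposite_weight_def nz)
    show "U' (c 1 2) * U' (c 2 3) * U' (c 3 1) > 0"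
      by (simp add: pos)
    show "U' (a i \<bullet> a j) = U' (c 1 2) * U' (c 2 3) * U' (c 3 1) * r i * r j" if "i \<noteq> j" for i j
      using U'_eq_opposite_weights[of c U', OF _ nz that] by (simp add: r_def c_def inner_commute)
    show "(\<Sum>j\<in>UNIV. m j * r j * (a k \<bullet> a j)) = \<mu> * r k" for k
      using eigen by (simp add: c_def)
  qed
  then obtain x \<omega> where arc: "\<And>i j. cos_arc x i j = a i \<bullet> a j" and balanced: "balanced m U' \<omega> x"
    by blast
  define q where "q = (\<lambda>t. (fst x, snd x + (\<omega> * t) *\<^sub>R 1))"
  have q_inner: "a i \<bullet> a j = position (q t) i \<bullet> position (q t) j" for t i j
    by (simp add: inner_position flip: arc) (simp add: q_def cos_arc_def)
  have "(U has_real_derivative U' (cos_arc x i j)) (at (cos_arc x i j))" if "i \<noteq> j" for i j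
    using U_deriv[OF c_bounds[OF that]] by (simp add: c_def arc)
  from balanced_imp_relative_equilibrium[OF this balanced] have "relative_equilibrium m U q"
    by (simp add: q_def)
  moreover have "\<not> on_common_geodesic (position (q t))" for t
    using nongeodesic q_inner by (rule nongeodesic_cong_inner)
  moreover have "has_shape (position (q t)) \<sigma>" for t
    using shape by (simp add: has_shape_def arc_angle_def q_inner[of _ _ t])
  ultimately show ?thesis
    unfolding forms_lagrangian_RE_def lagrangian_RE_def by blast
qed

theorem theorem3:
  fixes m :: "3 \<Rightarrow> real" and U U' :: "real \<Rightarrow> real" and \<sigma> :: "3 \<Rightarrow> 3 \<Rightarrow> real"
  assumes mass_pos: "\<And>k. m k > 0"
    and U_deriv: "\<And>c. c \<in> {-1<..<1} \<Longrightarrow> (U has_real_derivative U' c) (at c)"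
    and U'_cont: "continuous_on {-1<..<1} U'"
    and U'_sign: "(\<forall>c\<in>{-1<..<1}. U' c > 0) \<or> (\<forall>c\<in>{-1<..<1}. U' c < 0)"
    and shape: "nongeodesic_shape \<sigma>"
  shows "((\<forall>c\<in>{-1<..<1}. U' c > 0) \<longrightarrow>
            (forms_lagrangian_RE m U \<sigma> \<longleftrightarrow> has_eigenvector (J_mat m \<sigma>) (Psi_L m U' \<sigma>))) \<and>
         ((\<forall>c\<in>{-1<..<1}. U' c < 0) \<longrightarrow>
            (forms_lagrangian_RE m U \<sigma> \<longrightarrow> has_eigenvector (J_mat m \<sigma>) (Psi_L m U' \<sigma>)))"
proof -
  have nz: "U' c \<noteq> 0" if "c \<in> {-1<..<1}" for c
    using U'_sign that by force
  have "has_eigenvector (J_mat m \<sigma>) (Psi_L m U' \<sigma>)" if "forms_lagrangian_RE m U \<sigma>"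
    using mass_pos U_deriv nz that by (rule forms_lagrangian_RE_imp_eigenvector)
  moreover have "forms_lagrangian_RE m U \<sigma>"
    if "\<forall>c\<in>{-1<..<1}. U' c > 0" "has_eigenvector (J_mat m \<sigma>) (Psi_L m U' \<sigma>)"
    using mass_pos U_deriv that(1)[rule_format] shape that(2)
    by (rule eigenvector_imp_forms_lagrangian_RE)
  ultimately show ?thesis
    by blast
qed

end
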